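(* Let $G = \langle R \cup D \rangle$ be a layered constant spinal group. Then $G$ has the congruence subgroup property if and only if $G$ is perfect.
   Context: For a finite non-empty set $X$, $X^\ast$ denotes the rooted tree of finite words over $X$; $X^n$ is the set of words of length $n$. $\mathrm{Aut}(X^\ast)$ acts on the left. For $g\in\mathrm{Aut}(X^\ast)$ and $v\in X^\ast$, the section $g|_v\in \mathrm{Aut}(X^\ast)$ is defined by $g(vu)=g(v)\,g|_v(u)$ for all $u\in X^\ast$. Constant spinal groups: let $R$ be a finite group with identity $e$, let $X=\underline{R}$ be its underlying set, and write $\underline{r}\in X$ for the letter corresponding to $r\in R$. The group $R$ acts on $X$ by $r\underline{s}=\underline{rs}$, and $r\in R$ is identified with the rooted automorphism $\underline{s}w\mapsto \underline{rs}\,w$ of $X^\ast$. An automorphism $d$ is directed if it fixes every word of length $1$, $d|_{\underline{e}}=d$, and $d|_x\in R$ for all $x\in X\smallsetminus\{\underline{e}\}$. Let $D$ be a group of directed automorphisms with $\langle d|_x \mid d\in D,\ x\in X\smallsetminus\{\underline{e}\}\rangle = R$. Then $G=\langle R\cup D\rangle$ is called a constant spinal group. (Such a group is spherically transitive and self-similar, i.e. transitive on each $X^n$ and closed under taking sections.) For $g_x\in\mathrm{Aut}(X^\ast)$ $(x\in X)$, $(x:g_x)_{x\in X}$ denotes the automorphism fixing $X$ pointwise with section $g_x$ at $x$. A self-similar spherically transitive group $G$ is layered if it is regular branch over itself, i.e. $(x:g_x)_{x\in X}\in G$ for all choices of $g_x\in G$. $\mathrm{St}_G(n)$ is the pointwise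 stabiliser of $X^n$ in $G$. $G$ has the congruence subgroup property if every normal subgroup of finite index in $G$ contains $\mathrm{St}_G(n)$ for some $n$. A group is perfect if it equals its commutator subgroup. *)

theory Defs
  imports "HOL-Algebra.Bij" "HOL-Algebra.Generated_Groups"
begin

section \<open>Automorphisms of the tree of words\<close>

text \<open>The vertices of the rooted tree \<open>X\<^sup>*\<close> are the elements of \<^term>\<open>lists X\<close>, the root is
  \<^term>\<open>[]\<close>, and the children of \<open>v\<close> are the words \<open>v @ [x]\<close> with \<open>x \<in> X\<close>.\<close>

definition child_of :: "'a list \<Rightarrow> 'a list \<Rightarrow> bool" where
  "child_of w v \<longleftrightarrow> (\<exists>x. w = v @ [x])"

definition tree_auts :: "'a set \<Rightarrow> ('a list \<Rightarrow> 'a list) set" where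
  "tree_auts X = {g \<in> Bij (lists X). g [] = [] \<and>
     (\<forall>v\<in>lists X. \<forall>w\<in>lists X. child_of (g w) (g v) \<longleftrightarrow> child_of w v)}"

definition Aut_tree :: "'a set \<Rightarrow> ('a list \<Rightarrow> 'a list) monoid" where
  "Aut_tree X = BijGroup (lists X) \<lparr>carrier := tree_auts X\<rparr>"

text \<open>The section of \<open>g\<close> at \<open>v\<close>, i.e. the automorphism \<open>h\<close> with \<open>g (v @ u) = g v @ h u\<close> for all
  words \<open>u\<close>. Dropping a prefix of length \<^term>\<open>length v\<close> is correct because \<open>g\<close> preserves lengths
  and prefixes; see \<open>append_sect\<close> and \<open>sect_unique\<close>.\<close>

definition sect :: "'a set \<Rightarrow> ('a list \<Rightarrow> 'a list) \<Rightarrow> 'a list \<Rightarrow> 'a list \<Rightarrow> 'a list" where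
  "sect X g v = (\<lambda>u\<in>lists X. drop (length v) (g (v @ u)))"

text \<open>The automorphism \<open>(x : h x)\<^bsub>x \<in> X\<^esub>\<close>.\<close>

definition diag_aut :: "'a set \<Rightarrow> ('a \<Rightarrow> 'a list \<Rightarrow> 'a list) \<Rightarrow> 'a list \<Rightarrow> 'a list" where
  "diag_aut X h = (\<lambda>w\<in>lists X. case w of [] \<Rightarrow> [] | x # u \<Rightarrow> x # h x u)"

subsection \<open>Properties of groups of tree automorphisms\<close>

definition self_similar :: "'a set \<Rightarrow> ('a list \<Rightarrow> 'a list) monoid \<Rightarrow> bool" where
  "self_similar X G \<longleftrightarrow> (\<forall>g\<in>carrier G. \<forall>v\<in>lists X. sect X g v \<in> carrier G)"

definition spherically_transitive :: "'a set \<Rightarrow> ('a list \<Rightarrow> 'a list) monoid \<Rightarrow> bool" where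
  "spherically_transitive X G \<longleftrightarrow>
     (\<forall>v\<in>lists X. \<forall>w\<in>lists X. length v = length w \<longrightarrow> (\<exists>g\<in>carrier G. g v = w))"

definition layered :: "'a set \<Rightarrow> ('a list \<Rightarrow> 'a list) monoid \<Rightarrow> bool" where
  "layered X G \<longleftrightarrow> self_similar X G \<and> spherically_transitive X G \<and>
     (\<forall>h. (\<forall>x\<in>X. h x \<in> carrier G) \<longrightarrow> diag_aut X h \<in> carrier G)"

definition level_stabiliser ::
    "'a set \<Rightarrow> ('a list \<Rightarrow> 'a list) monoid \<Rightarrow> nat \<Rightarrow> ('a list \<Rightarrow> 'a list) set" where
  "level_stabiliser X G n = {g \<in> carrier G. \<forall>v\<in>lists X. length v = n \<longrightarrow> g v = v}"

definition congruence_subgroup_property :: "'a set \<Rightarrow> ('a list \<Rightarrow> 'a list) monoid \<Rightarrow> bool" where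
  "congruence_subgroup_property X G \<longleftrightarrow>
     (\<forall>N. N \<lhd> G \<and> finite (rcosets\<^bsub>G\<^esub> N) \<longrightarrow> (\<exists>n. level_stabiliser X G n \<subseteq> N))"

definition perfect_group :: "('a, 'b) monoid_scheme \<Rightarrow> bool" where
  "perfect_group G \<longleftrightarrow> derived G (carrier G) = carrier G"

section \<open>Constant spinal groups\<close>

text \<open>The alphabet is the underlying set \<^term>\<open>carrier R\<close> of the group \<open>R\<close>.\<close>

definition rooted :: "('a, 'b) monoid_scheme \<Rightarrow> 'a \<Rightarrow> 'a list \<Rightarrow> 'a list" where
  "rooted R r = (\<lambda>w\<in>lists (carrier R). case w of [] \<Rightarrow> [] | s # u \<Rightarrow> (r \<otimes>\<^bsub>R\<^esub> s) # u)"

definition directed :: "('a, 'b) monoid_scheme \<Rightarrow> ('a list \<Rightarrow> 'a list) \<Rightarrow> bool" where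
  "directed R d \<longleftrightarrow> d \<in> tree_auts (carrier R) \<and>
     (\<forall>x\<in>carrier R. d [x] = [x]) \<and>
     sect (carrier R) d [\<one>\<^bsub>R\<^esub>] = d \<and>
     (\<forall>x\<in>carrier R - {\<one>\<^bsub>R\<^esub>}. sect (carrier R) d [x] \<in> rooted R ` carrier R)"

locale constant_spinal = group R for R (structure) +
  fixes D :: "('a list \<Rightarrow> 'a list) set"
  assumes finite_R: "finite (carrier R)"
    and subgroup_D: "subgroup D (Aut_tree (carrier R))"
    and directed_D: "\<And>d. d \<in> D \<Longrightarrow> directed R d"
    and generate_sections:
      "generate (Aut_tree (carrier R))
         {sect (carrier R) d [x] | d x. d \<in> D \<and> x \<in> carrier R - {\<one>}} = rooted R ` carrier R"

definition spinal_group ::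
    "('a, 'b) monoid_scheme \<Rightarrow> ('a list \<Rightarrow> 'a list) set \<Rightarrow> ('a list \<Rightarrow> 'a list) monoid" where
  "spinal_group R D = Aut_tree (carrier R)
     \<lparr>carrier := generate (Aut_tree (carrier R)) (rooted R ` carrier R \<union> D)\<rparr>"

section \<open>Basic facts\<close>

lemma tree_autsD:
  assumes "g \<in> tree_auts X"
  shows "g \<in> extensional (lists X)" "bij_betw g (lists X) (lists X)" "g [] = []"
    "\<And>v w. v \<in> lists X \<Longrightarrow> w \<in> lists X \<Longrightarrow> child_of (g w) (g v) \<longleftrightarrow> child_of w v"
    "\<And>v. v \<in> lists X \<Longrightarrow> g v \<in> lists X"
  using assms by (auto simp: tree_auts_def Bij_def dest: bij_betwE simp del: in_lists_conv_set)

lemma tree_aut_snoc: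
  assumes "g \<in> tree_auts X" "v \<in> lists X" "x \<in> X"
  obtains y where "y \<in> X" "g (v @ [x]) = g v @ [y]"
proof -
  have w: "v @ [x] \<in> lists X" using assms by simp
  have "child_of (g (v @ [x])) (g v)"
    using tree_autsD(4)[OF assms(1,2) w] by (simp add: child_of_def)
  then obtain y where y: "g (v @ [x]) = g v @ [y]" by (auto simp: child_of_def)
  moreover have "g (v @ [x]) \<in> lists X" using tree_autsD(5)[OF assms(1) w] .
  ultimately show thesis using that by auto
qed

lemma length_tree_aut:
  assumes "g \<in> tree_auts X" "v \<in> lists X"
  shows "length (g v) = length v"
  using assms(2)
proof (induction v rule: rev_induct)
  case Nil
  then show ?case using tree_autsD(3)[OF assms(1)] by simp
next
  case (snoc x v)
  then have vx: "v \<in> lists X" "x \<in> X" by auto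
  obtain y where "g (v @ [x]) = g v @ [y]" by (rule tree_aut_snoc[OF assms(1) vx])
  then show ?case using snoc.IH[OF vx(1)] by simp
qed

lemma append_sect:
  assumes g: "g \<in> tree_auts X" and v: "v \<in> lists X" and u: "u \<in> lists X"
  shows "g (v @ u) = g v @ sect X g v u"
proof -
  have "\<exists>t. g (v @ u) = g v @ t"
    using u
  proof (induction u rule: rev_induct)
    case (snoc x u)
    then have "v @ u \<in> lists X" "x \<in> X" using v by auto
    then obtain y where "g ((v @ u) @ [x]) = g (v @ u) @ [y]" by (rule tree_aut_snoc[OF g])
    with snoc show ?case by auto
  qed simp
  then show ?thesis using length_tree_aut[OF g v] u by (auto simp: sect_def)
qed

lemma sect_unique:
  assumes "g \<in> tree_auts X" "v \<in> lists X" "h \<in> extensional (lists X)"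
    and "\<And>u. u \<in> lists X \<Longrightarrow> g (v @ u) = g v @ h u"
  shows "h = sect X g v"
proof (rule extensionalityI[of _ "lists X"])
  show "h \<in> extensional (lists X)" by fact
  show "sect X g v \<in> extensional (lists X)" by (simp add: sect_def)
  show "h u = sect X g v u" if "u \<in> lists X" for u
    using append_sect[OF assms(1,2) that] assms(4)[OF that] by simp
qed

lemma sect_in_tree_auts:
  assumes g: "g \<in> tree_auts X" and v: "v \<in> lists X"
  shows "sect X g v \<in> tree_auts X"
proof -
  let ?h = "sect X g v"
  have app: "g (v @ u) = g v @ ?h u" if "u \<in> lists X" for u
    using append_sect[OF g v that] .
  have inj: "inj_on g (lists X)" and img: "g ` lists X = lists X"
    using tree_autsD(2)[OF g] by (auto simp: bij_betw_def)
  have clos: "?h u \<in> lists X" if "u \<in> lists X" for u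
    using tree_autsD(5)[OF g, of "v @ u"] app[OF that] that v by auto
  have injh: "inj_on ?h (lists X)"
  proof (rule inj_onI)
    fix a b assume ab: "a \<in> lists X" "b \<in> lists X" "?h a = ?h b"
    then have eq: "g (v @ a) = g (v @ b)" using app by simp
    have "v @ a \<in> lists X" "v @ b \<in> lists X" using ab v by auto
    then have "v @ a = v @ b" by (rule inj_onD[OF inj eq])
    then show "a = b" by simp
  qed
  have surjh: "\<exists>u\<in>lists X. t = ?h u" if t: "t \<in> lists X" for t
  proof -
    have gv: "g v \<in> lists X" using tree_autsD(5)[OF g v] .
    then have "g v @ t \<in> g ` lists X" using t img by auto
    then obtain w where w: "w \<in> lists X" "g w = g v @ t" by (metis imageE)
    have lw: "length w = length v + length t"
      using length_tree_aut[OF g w(1)] length_tree_aut[OF g v] w(2) by simp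
    have tk: "take (length v) w \<in> lists X" "drop (length v) w \<in> lists X"
      using w(1) by (auto dest: in_set_takeD in_set_dropD)
    have "g w = g (take (length v) w) @ sect X g (take (length v) w) (drop (length v) w)"
      using append_sect[OF g tk] by simp
    then have "g (take (length v) w) @ sect X g (take (length v) w) (drop (length v) w) = g v @ t"
      using w(2) by (rule trans[OF sym])
    moreover have "length (g (take (length v) w)) = length (g v)"
      unfolding length_tree_aut[OF g tk(1)] length_tree_aut[OF g v] using lw by simp
    ultimately have eq: "g (take (length v) w) = g v"
      by (metis append_eq_append_conv)
    have "take (length v) w = v" by (rule inj_onD[OF inj eq tk(1) v])
    then have "v @ drop (length v) w = w" by (metis append_take_drop_id)
    then have "g v @ t = g v @ ?h (drop (length v) w)" using app[OF tk(2)] w(2) by argo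
    then show ?thesis using tk(2) by blast
  qed
  have "bij_betw ?h (lists X) (lists X)"
    unfolding bij_betw_def
  proof (intro conjI injh equalityI subsetI)
    show "t \<in> lists X" if "t \<in> ?h ` lists X" for t using that clos by blast
    show "t \<in> ?h ` lists X" if "t \<in> lists X" for t using surjh[OF that] by blast
  qed
  moreover have "?h \<in> extensional (lists X)" by (simp add: sect_def)
  moreover have "?h [] = []" using app[of "[]"] by simp
  moreover have "child_of (?h b) (?h a) \<longleftrightarrow> child_of b a"
    if "a \<in> lists X" "b \<in> lists X" for a b
  proof -
    have "child_of (g (v @ b)) (g (v @ a)) \<longleftrightarrow> child_of (v @ b) (v @ a)"
      using that v by (intro tree_autsD(4)[OF g]) auto
    then show ?thesis
      unfolding app[OF that(1)] app[OF that(2)] by (simp add: child_of_def)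
  qed
  ultimately show ?thesis by (simp add: tree_auts_def Bij_def del: in_lists_conv_set)
qed

lemma subgroup_tree_auts: "subgroup (tree_auts X) (BijGroup (lists X))"
proof (rule group.subgroupI[OF group_BijGroup])
  show "tree_auts X \<subseteq> carrier (BijGroup (lists X))"
    by (auto simp: tree_auts_def BijGroup_def)
  have "(\<lambda>w\<in>lists X. w) \<in> tree_auts X"
    using id_Bij[of "lists X"] by (simp add: tree_auts_def del: in_lists_conv_set)
  then show "tree_auts X \<noteq> {}" by blast
next
  fix g assume g: "g \<in> tree_auts X"
  have bij: "g \<in> Bij (lists X)" using g by (simp add: tree_auts_def)
  let ?i = "\<lambda>x\<in>lists X. inv_into (lists X) g x"
  have i: "?i \<in> Bij (lists X)" by (rule restrict_inv_into_Bij[OF bij])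
  have gi: "g (?i w) = w" "?i w \<in> lists X" if "w \<in> lists X" for w
    using that tree_autsD(2)[OF g]
    by (auto simp: bij_betw_def f_inv_into_f inv_into_into simp del: in_lists_conv_set)
  have "?i [] = []"
  proof -
    have "inj_on g (lists X)" using tree_autsD(2)[OF g] by (simp add: bij_betw_def)
    moreover have "g (?i []) = g []" using gi(1)[of "[]"] tree_autsD(3)[OF g] by simp
    ultimately show ?thesis using gi(2)[of "[]"] by (meson inj_onD lists.Nil)
  qed
  moreover have "child_of (?i w) (?i v) \<longleftrightarrow> child_of w v"
    if "v \<in> lists X" "w \<in> lists X" for v w
    using tree_autsD(4)[OF g gi(2)[OF that(1)] gi(2)[OF that(2)]]
    unfolding gi(1)[OF that(1)] gi(1)[OF that(2)] by (rule sym)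
  ultimately have "?i \<in> tree_auts X" using i by (simp add: tree_auts_def del: in_lists_conv_set)
  then show "inv\<^bsub>BijGroup (lists X)\<^esub> g \<in> tree_auts X" using inv_BijGroup[OF bij] by simp
next
  fix g h assume g: "g \<in> tree_auts X" and h: "h \<in> tree_auts X"
  have bij: "g \<in> Bij (lists X)" "h \<in> Bij (lists X)" using g h by (auto simp: tree_auts_def)
  have "compose (lists X) g h \<in> tree_auts X"
    using compose_Bij[OF bij] tree_autsD(3-5)[OF g] tree_autsD(3-5)[OF h]
    by (simp add: tree_auts_def compose_def del: in_lists_conv_set)
  then show "g \<otimes>\<^bsub>BijGroup (lists X)\<^esub> h \<in> tree_auts X" using bij by (simp add: BijGroup_def)
qed

lemma group_Aut_tree: "group (Aut_tree X)"
  unfolding Aut_tree_def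
  by (rule group.subgroup_imp_group[OF group_BijGroup subgroup_tree_auts])

lemma (in group) rooted_in_tree_auts:
  assumes r: "r \<in> carrier G"
  shows "rooted G r \<in> tree_auts (carrier G)"
proof -
  let ?L = "lists (carrier G)"
  have clos: "rooted G s w \<in> ?L" if "s \<in> carrier G" "w \<in> ?L" for s w
    using that by (cases w) (auto simp: rooted_def)
  have canc: "rooted G s (rooted G (inv s) w) = w" "rooted G (inv s) (rooted G s w) = w"
    if "s \<in> carrier G" "w \<in> ?L" for s w
    using that by (cases w; auto simp: rooted_def m_assoc[symmetric])+
  have "bij_betw (rooted G r) ?L ?L"
    by (rule bij_betw_byWitness[where f' = "rooted G (inv r)"]) (use r clos canc in blast)+
  moreover have "rooted G r \<in> extensional ?L" by (simp add: rooted_def)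
  moreover have "rooted G r [] = []" by (simp add: rooted_def)
  moreover have "child_of (rooted G r w) (rooted G r v) \<longleftrightarrow> child_of w v"
    if "v \<in> ?L" "w \<in> ?L" for v w
    using that r by (cases v; cases w) (auto simp: rooted_def child_of_def Cons_eq_append_conv)
  ultimately show ?thesis by (simp add: tree_auts_def Bij_def del: in_lists_conv_set)
qed

lemma (in constant_spinal) group_spinal_group: "group (spinal_group R D)"
proof -
  have "rooted R ` carrier R \<union> D \<subseteq> carrier (Aut_tree (carrier R))"
    using rooted_in_tree_auts directed_D by (auto simp: Aut_tree_def directed_def)
  then show ?thesis
    unfolding spinal_group_def
    by (intro group.subgroup_imp_group[OF group_Aut_tree]
        group.generate_is_subgroup[OF group_Aut_tree])
qed

end

theory Submission
  imports Defs "HOL-Algebra.FiniteProduct"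
begin

text \<open>
  Write \<open>\<delta>\<^sub>v a\<close> for the automorphism (\<open>at_vertex\<close>) that acts as \<open>a\<close> on the subtree below the vertex \<open>v\<close> and fixes
  every other word. A layered group \<open>G\<close> contains \<open>\<delta>\<^sub>v a\<close> for all \<open>v\<close> and all \<open>a \<in> G\<close>, so the stabiliser
  of level \<open>n\<close> is the direct product of copies of \<open>G\<close>, one for each word of length \<open>n\<close>. Both
  implications compare this product with the commutator subgroup \<open>G'\<close>.

  Let \<open>G\<close> be perfect and let \<open>N\<close> be a normal subgroup containing some \<open>g\<close> with \<open>g v \<noteq> v\<close>. The
  commutator of \<open>\<delta>\<^sub>v a\<close> and \<open>g\<close> lies in \<open>N\<close> and is \<open>\<delta>\<^sub>v a\<close> times an element supported below \<open>g v\<close>.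
  The second factor commutes with \<open>\<delta>\<^sub>v b\<close>, so a further commutator with \<open>\<delta>\<^sub>v b\<close> shows
  \<open>\<delta>\<^sub>v [a, b] \<in> N\<close>. As \<open>G\<close> is perfect, \<open>N\<close> contains the whole copy of \<open>G\<close> at \<open>v\<close>, by transitivity all
  copies on the level of \<open>v\<close>, and hence the stabiliser of that level
  (\<open>perfect_nontrivial_normal_contains_level_stabiliser\<close>). If the trivial subgroup has
  finite index, then \<open>G\<close> is finite and some level stabiliser is trivial.

  Conversely, multiplying the classes in \<open>G/G'\<close> of the sections of \<open>g\<close> at all words of length \<open>n\<close>
  gives a homomorphism \<open>\<tau>\<close> from \<open>G\<close> to the abelian group \<open>G/G'\<close> (\<open>section_product_hom\<close>). It kills \<open>G'\<close> and sends
  \<open>\<delta>\<^sub>v a\<close> to the class of \<open>a\<close>. If \<open>G'\<close> contains the stabiliser of level \<open>n\<close>, then \<open>\<tau> (\<delta>\<^sub>v a)\<close> is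
  trivial for every \<open>a\<close>, so \<open>G = G'\<close> (\<open>level_stabiliser_in_derived_imp_perfect\<close>). The congruence
  subgroup property provides such an \<open>n\<close> because \<open>G'\<close> has finite index: \<open>G\<close> is generated by \<open>R\<close> and
  \<open>D\<close>, and \<open>D\<close> is finite since a directed automorphism is determined by its
  sections at the letters other than the identity (\<open>finite_D\<close>).
\<close>

section \<open>Commutators and abelianisations of groups\<close>

text \<open>In the abelian quotient the images of \<open>A\<close> and \<open>B\<close> commute, so every element of it is the image
  of some product \<open>a \<otimes> b\<close>.\<close>

lemma (in group) finite_abelianisation:
  assumes A: "subgroup A G" "finite A" and B: "subgroup B G" "finite B"
    and gen: "carrier G = generate G (A \<union> B)"
  shows "finite (rcosets (derived G (carrier G)))"
proof -
  let ?N = "derived G (carrier G)"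
  interpret N: normal ?N G by (rule derived_self_is_normal)
  interpret Q: comm_group "G Mod ?N" by (rule derived_quot_is_comm_group)
  let ?p = "\<lambda>g. ?N #> g"
  have sub: "A \<subseteq> carrier G" "B \<subseteq> carrier G" using A B by (auto dest: subgroup.subset)
  have p: "?p \<in> hom G (G Mod ?N)" by (rule N.r_coset_hom_Mod)
  have pc: "?p g \<in> carrier (G Mod ?N)" if "g \<in> carrier G" for g
    using hom_in_carrier[OF p that] .
  have "\<exists>a\<in>A. \<exists>b\<in>B. ?p g = ?p (a \<otimes> b)" if "g \<in> generate G (A \<union> B)" for g
    using that
  proof induction
    case one
    have "?p \<one> = ?p (\<one> \<otimes> \<one>)" by simp
    then show ?case
      using subgroup.one_closed[OF A(1)] subgroup.one_closed[OF B(1)] by blast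
  next
    case (incl g)
    then have "g = g \<otimes> \<one>" "g = \<one> \<otimes> g" using sub by auto
    then show ?case
      using incl subgroup.one_closed[OF A(1)] subgroup.one_closed[OF B(1)] by (metis Un_iff)
  next
    case (inv g)
    then have "inv g \<in> A \<or> inv g \<in> B"
      using subgroup.m_inv_closed[OF A(1)] subgroup.m_inv_closed[OF B(1)] by blast
    moreover have "inv g = inv g \<otimes> \<one>" "inv g = \<one> \<otimes> inv g" using inv sub by auto
    ultimately show ?case
      using subgroup.one_closed[OF A(1)] subgroup.one_closed[OF B(1)] by metis
  next
    case (eng g h)
    then obtain a b a' b' where *: "a \<in> A" "b \<in> B" "?p g = ?p (a \<otimes> b)"
      "a' \<in> A" "b' \<in> B" "?p h = ?p (a' \<otimes> b')" by blast
    have c: "a \<in> carrier G" "b \<in> carrier G" "a' \<in> carrier G" "b' \<in> carrier G"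
      "g \<in> carrier G" "h \<in> carrier G"
      using * sub eng gen by auto
    have "?p (g \<otimes> h) = ?p (a \<otimes> b) \<otimes>\<^bsub>G Mod ?N\<^esub> ?p (a' \<otimes> b')"
      using hom_mult[OF p c(5,6)] *(3,6) by simp
    also have "\<dots> = (?p a \<otimes>\<^bsub>G Mod ?N\<^esub> ?p b) \<otimes>\<^bsub>G Mod ?N\<^esub> (?p a' \<otimes>\<^bsub>G Mod ?N\<^esub> ?p b')"
      using hom_mult[OF p c(1,2)] hom_mult[OF p c(3,4)] by argo
    also have "\<dots> = (?p a \<otimes>\<^bsub>G Mod ?N\<^esub> ?p a') \<otimes>\<^bsub>G Mod ?N\<^esub> (?p b \<otimes>\<^bsub>G Mod ?N\<^esub> ?p b')"
      using pc[OF c(1)] pc[OF c(2)] pc[OF c(3)] pc[OF c(4)]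
      by (simp only: Q.m_ac Q.m_closed)
    also have "\<dots> = ?p (a \<otimes> a' \<otimes> (b \<otimes> b'))"
      using hom_mult[OF p c(1,3)] hom_mult[OF p c(2,4)]
        hom_mult[OF p m_closed[OF c(1,3)] m_closed[OF c(2,4)]] by argo
    finally show ?case
      using * subgroup.m_closed[OF A(1)] subgroup.m_closed[OF B(1)] by blast
  qed
  then have "?p ` carrier G \<subseteq> (\<lambda>(a, b). ?p (a \<otimes> b)) ` (A \<times> B)"
    using gen by fastforce
  moreover have "finite ((\<lambda>(a, b). ?p (a \<otimes> b)) ` (A \<times> B))" using A B by blast
  moreover have "rcosets ?N = ?p ` carrier G" by (auto simp: RCOSETS_def)
  ultimately show ?thesis by (simp add: finite_subset)
qed

text \<open>Since \<open>c\<close> commutes with \<open>b\<close>, it cancels from the commutator of \<open>a \<otimes> c\<close> and \<open>b\<close>, which lies in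
  the normal subgroup.\<close>

lemma (in normal) commutator_of_commuting_factor:
  assumes "a \<in> carrier G" "c \<in> carrier G" "b \<in> carrier G"
    and "a \<otimes> c \<in> H" and "c \<otimes> b = b \<otimes> c"
  shows "a \<otimes> b \<otimes> inv a \<otimes> inv b \<in> H"
proof -
  let ?k = "a \<otimes> c"
  have "b \<otimes> inv ?k \<otimes> inv b \<in> H"
    using assms(3) subgroup.m_inv_closed[OF is_subgroup assms(4)] by (rule inv_op_closed2)
  then have "?k \<otimes> (b \<otimes> inv ?k \<otimes> inv b) \<in> H" by (rule subgroup.m_closed[OF is_subgroup assms(4)])
  moreover have "?k \<otimes> (b \<otimes> inv ?k \<otimes> inv b) = a \<otimes> (c \<otimes> b) \<otimes> inv c \<otimes> inv a \<otimes> inv b"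
    using assms(1-3) by (simp add: inv_mult_group m_assoc)
  moreover have "\<dots> = a \<otimes> b \<otimes> inv a \<otimes> inv b"
    using assms(1-3) unfolding assms(5) by (simp add: m_assoc inv_solve_left)
  ultimately show ?thesis by simp
qed

section \<open>Automorphisms supported below a vertex\<close>

definition at_vertex :: "'a set \<Rightarrow> 'a list \<Rightarrow> ('a list \<Rightarrow> 'a list) \<Rightarrow> 'a list \<Rightarrow> 'a list" where
  "at_vertex X v a =
     (\<lambda>w\<in>lists X. if take (length v) w = v then v @ a (drop (length v) w) else w)"

lemma at_vertex_below:
  "v \<in> lists X \<Longrightarrow> u \<in> lists X \<Longrightarrow> at_vertex X v a (v @ u) = v @ a u"
  by (simp add: at_vertex_def)

lemma at_vertex_elsewhere:
  "w \<in> lists X \<Longrightarrow> take (length v) w \<noteq> v \<Longrightarrow> at_vertex X v a w = w"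
  by (simp add: at_vertex_def)

lemma at_vertex_Nil: "a \<in> extensional (lists X) \<Longrightarrow> at_vertex X [] a = a"
  by (auto simp: at_vertex_def extensional_def fun_eq_iff)

text \<open>This recursion is how closure of \<open>G\<close> under \<^const>\<open>diag_aut\<close>, which concerns the first level only,
  reaches vertices of arbitrary depth.\<close>

lemma at_vertex_Cons:
  assumes "x \<in> X"
  shows "at_vertex X (x # v) a =
    diag_aut X (\<lambda>y. if y = x then at_vertex X v a else (\<lambda>w\<in>lists X. w))"
  by (auto simp: at_vertex_def diag_aut_def fun_eq_iff split: list.splits)

section \<open>Calculating in layered groups of tree automorphisms\<close>

text \<open>The equation \<open>G_eq\<close> makes the multiplication of \<open>G\<close> composition on words; the alphabet must be
  nonempty so that there are words of every length.\<close>

locale layered_tree_group =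
  fixes X :: "'a set" and G :: "('a list \<Rightarrow> 'a list) monoid" (structure)
  assumes finite_X: "finite X" and nonempty_X: "X \<noteq> {}"
    and subgroup_G: "subgroup (carrier G) (Aut_tree X)"
    and G_eq: "G = Aut_tree X\<lparr>carrier := carrier G\<rparr>"
    and layered_G: "layered X G"
begin

sublocale group G
proof -
  have "group (Aut_tree X\<lparr>carrier := carrier G\<rparr>)"
    by (rule group.subgroup_imp_group[OF group_Aut_tree subgroup_G])
  then show "group G" using G_eq by simp
qed

lemma carrier_tree_auts: "g \<in> carrier G \<Longrightarrow> g \<in> tree_auts X"
  using subgroup.subset[OF subgroup_G] by (auto simp: Aut_tree_def)

lemmas closed_word = tree_autsD(5)[OF carrier_tree_auts]
lemmas length_word = length_tree_aut[OF carrier_tree_auts]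
lemmas word_sect = append_sect[OF carrier_tree_auts]

lemma mult_eq_compose:
  assumes "g \<in> carrier G" "h \<in> carrier G"
  shows "g \<otimes> h = compose (lists X) g h"
proof -
  have "g \<otimes> h = g \<otimes>\<^bsub>Aut_tree X\<lparr>carrier := carrier G\<rparr>\<^esub> h" using G_eq by simp
  then show ?thesis
    using assms[THEN carrier_tree_auts]
    by (simp add: Aut_tree_def BijGroup_def tree_auts_def)
qed

lemma mult_word:
  "g \<in> carrier G \<Longrightarrow> h \<in> carrier G \<Longrightarrow> w \<in> lists X \<Longrightarrow> (g \<otimes> h) w = g (h w)"
  by (simp add: mult_eq_compose compose_def)

lemma one_eq: "\<one> = (\<lambda>w\<in>lists X. w)"
proof -
  have "\<one> = \<one>\<^bsub>Aut_tree X\<lparr>carrier := carrier G\<rparr>\<^esub>" using G_eq by simp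
  then show ?thesis by (simp add: Aut_tree_def BijGroup_def)
qed

lemma one_word: "w \<in> lists X \<Longrightarrow> \<one> w = w"
  by (simp add: one_eq)

lemma inv_word:
  assumes "g \<in> carrier G" "w \<in> lists X"
  shows "g ((inv g) w) = w" "(inv g) (g w) = w"
  using mult_word[of g "inv g" w] mult_word[of "inv g" g w] assms by (simp_all add: one_word)

lemma inj_word:
  "g \<in> carrier G \<Longrightarrow> v \<in> lists X \<Longrightarrow> w \<in> lists X \<Longrightarrow> g v = g w \<longleftrightarrow> v = w"
  using inv_word(2) by metis

lemma word_eqI:
  assumes "g \<in> carrier G" "h \<in> carrier G" "\<And>w. w \<in> lists X \<Longrightarrow> g w = h w"
  shows "g = h"
  using extensionalityI[OF tree_autsD(1)[OF carrier_tree_auts[OF assms(1)]]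
      tree_autsD(1)[OF carrier_tree_auts[OF assms(2)]]] assms(3) by blast

lemma sect_closed: "g \<in> carrier G \<Longrightarrow> v \<in> lists X \<Longrightarrow> sect X g v \<in> carrier G"
  using layered_G by (simp add: layered_def self_similar_def del: in_lists_conv_set)

lemma sect_eqI:
  assumes "g \<in> carrier G" "v \<in> lists X" "h \<in> carrier G"
    and "\<And>u. u \<in> lists X \<Longrightarrow> g (v @ u) = g v @ h u"
  shows "sect X g v = h"
  using sect_unique[OF carrier_tree_auts[OF assms(1)] assms(2)
      tree_autsD(1)[OF carrier_tree_auts[OF assms(3)]] assms(4)] by simp

lemma sect_mult:
  assumes g: "g \<in> carrier G" and h: "h \<in> carrier G" and v: "v \<in> lists X"
  shows "sect X (g \<otimes> h) v = sect X g (h v) \<otimes> sect X h v"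
proof (rule sect_eqI)
  show "sect X g (h v) \<otimes> sect X h v \<in> carrier G"
    using assms closed_word by (simp add: sect_closed del: in_lists_conv_set)
  show "(g \<otimes> h) (v @ u) = (g \<otimes> h) v @ (sect X g (h v) \<otimes> sect X h v) u"
    if u: "u \<in> lists X" for u
  proof -
    have vu: "v @ u \<in> lists X" using u v by simp
    have hv: "h v \<in> lists X" using closed_word[OF h v] .
    have su: "sect X h v u \<in> lists X" using closed_word[OF sect_closed[OF h v] u] .
    show ?thesis
      unfolding mult_word[OF g h vu] mult_word[OF g h v] word_sect[OF h v u] word_sect[OF g hv su]
        mult_word[OF sect_closed[OF g hv] sect_closed[OF h v] u] ..
  qed
qed (use assms in auto)

lemma at_vertex_closed:
  assumes "v \<in> lists X" "a \<in> carrier G"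
  shows "at_vertex X v a \<in> carrier G"
  using assms(1)
proof (induction v)
  case Nil
  then show ?case using assms(2) tree_autsD(1)[OF carrier_tree_auts] by (simp add: at_vertex_Nil)
next
  case (Cons x v)
  have "\<And>h. (\<forall>y\<in>X. h y \<in> carrier G) \<Longrightarrow> diag_aut X h \<in> carrier G"
    using layered_G by (simp add: layered_def)
  then show ?case
    using Cons one_closed unfolding one_eq by (simp add: at_vertex_Cons)
qed

lemma word_cases_at:
  assumes "w \<in> lists X"
  obtains u where "u \<in> lists X" "w = v @ u" | "take (length v) w \<noteq> v"
proof (cases "take (length v) w = v")
  case True
  then have "w = v @ drop (length v) w" by (metis append_take_drop_id)
  moreover have "drop (length v) w \<in> lists X" using assms by (auto dest: in_set_dropD)
  ultimately show thesis using that by blast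
qed (use that in blast)

lemma at_vertex_mult:
  assumes v: "v \<in> lists X" and a: "a \<in> carrier G" and b: "b \<in> carrier G"
  shows "at_vertex X v (a \<otimes> b) = at_vertex X v a \<otimes> at_vertex X v b"
proof (rule word_eqI)
  note cl = at_vertex_closed[OF v a] at_vertex_closed[OF v b]
  fix w assume w: "w \<in> lists X"
  have "at_vertex X v (a \<otimes> b) w = at_vertex X v a (at_vertex X v b w)"
    using w
  proof (cases rule: word_cases_at[of w v])
    case (1 u)
    then show ?thesis
      using v a b by (simp add: at_vertex_below mult_word closed_word del: in_lists_conv_set)
  qed (use w in \<open>simp_all add: at_vertex_elsewhere del: in_lists_conv_set\<close>)
  then show "at_vertex X v (a \<otimes> b) w = (at_vertex X v a \<otimes> at_vertex X v b) w"
    unfolding mult_word[OF cl w] .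
qed (use assms at_vertex_closed in simp_all)

lemma at_vertex_hom: "v \<in> lists X \<Longrightarrow> group_hom G G (at_vertex X v)"
  by (intro group_hom.intro group_hom_axioms.intro homI is_group)
    (simp_all add: at_vertex_closed at_vertex_mult del: in_lists_conv_set)

lemma at_vertex_stabilises_level:
  assumes "v \<in> lists X" "a \<in> carrier G"
  shows "at_vertex X v a \<in> level_stabiliser X G (length v)"
proof -
  have "at_vertex X v a w = w" if "w \<in> lists X" "length w = length v" for w
    using that assms tree_autsD(3)[OF carrier_tree_auts] by (simp add: at_vertex_def)
  then show ?thesis using at_vertex_closed[OF assms] by (simp add: level_stabiliser_def)
qed

lemma sect_at_vertex:
  assumes v: "v \<in> lists X" and a: "a \<in> carrier G" and w: "w \<in> lists X" "length w = length v"
  shows "sect X (at_vertex X v a) w = (if w = v then a else \<one>)"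
proof (rule sect_eqI)
  have fix_w: "at_vertex X v a w = w"
    using at_vertex_stabilises_level[OF v a] w by (simp add: level_stabiliser_def)
  show "at_vertex X v a (w @ u) = at_vertex X v a w @ (if w = v then a else \<one>) u"
    if u: "u \<in> lists X" for u
    unfolding fix_w using v w u 
    by (cases "w = v") (simp_all add: at_vertex_below at_vertex_elsewhere one_word)
qed (use assms in \<open>simp_all add: at_vertex_closed del: in_lists_conv_set\<close>)

lemma at_vertex_commute:
  assumes u: "u \<in> lists X" and v: "v \<in> lists X" and ne: "u \<noteq> v" "length u = length v"
    and a: "a \<in> carrier G" and b: "b \<in> carrier G"
  shows "at_vertex X u a \<otimes> at_vertex X v b = at_vertex X v b \<otimes> at_vertex X u a"
proof (rule word_eqI)
  note cl = at_vertex_closed[OF u a] at_vertex_closed[OF v b]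
  fix w assume w: "w \<in> lists X"
  have "at_vertex X u a (at_vertex X v b w) = at_vertex X v b (at_vertex X u a w)"
    using w
  proof (cases rule: word_cases_at[of w u])
    case (1 t)
    then have "u @ a t \<in> lists X" using u a closed_word by simp
    then show ?thesis using 1 w u v ne
      by (simp add: at_vertex_below at_vertex_elsewhere del: in_lists_conv_set)
  next
    case 2
    note nu = this
    show ?thesis using w
    proof (cases rule: word_cases_at[of w v])
      case (1 t)
      then have "v @ b t \<in> lists X" using v b closed_word by simp
      then show ?thesis using 1 w u v ne
        by (simp add: at_vertex_below at_vertex_elsewhere del: in_lists_conv_set)
    next
      case 2
      then show ?thesis using nu w by (simp add: at_vertex_elsewhere del: in_lists_conv_set)
    qed
  qed
  then show "(at_vertex X u a \<otimes> at_vertex X v b) w = (at_vertex X v b \<otimes> at_vertex X u a) w"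
    using w cl by (simp add: mult_word del: in_lists_conv_set)
qed (use u v a b in \<open>simp_all add: at_vertex_closed del: in_lists_conv_set\<close>)

text \<open>Conjugation by \<open>g\<close> carries the copy of \<open>G\<close> at \<open>v\<close> to the copy at \<open>g v\<close>, and this identification
  is conjugation by the section of \<open>g\<close> at \<open>v\<close>.\<close>

lemma conjugate_at_vertex:
  assumes g: "g \<in> carrier G" and v: "v \<in> lists X" and a: "a \<in> carrier G"
  shows "g \<otimes> at_vertex X v a \<otimes> inv g =
    at_vertex X (g v) (sect X g v \<otimes> a \<otimes> inv (sect X g v))"
proof -
  let ?s = "sect X g v"
  have s: "?s \<in> carrier G" using sect_closed[OF g v] .
  have gv: "g v \<in> lists X" "length (g v) = length v"
    using closed_word[OF g v] length_word[OF g v] .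
  have av: "at_vertex X v a \<in> carrier G" using at_vertex_closed[OF v a] .
  have c: "?s \<otimes> a \<otimes> inv ?s \<in> carrier G" using s a by simp
  note cc = at_vertex_closed[OF gv(1) c]
  have "g \<otimes> at_vertex X v a = at_vertex X (g v) (?s \<otimes> a \<otimes> inv ?s) \<otimes> g"
  proof (rule word_eqI)
    fix w assume w: "w \<in> lists X"
    have "g (at_vertex X v a w) = at_vertex X (g v) (?s \<otimes> a \<otimes> inv ?s) (g w)"
      using w
    proof (cases rule: word_cases_at[of w v])
      case (1 u)
      have au: "a u \<in> lists X" "?s u \<in> lists X"
        using closed_word[OF a 1(1)] closed_word[OF s 1(1)] .
      have "(?s \<otimes> a \<otimes> inv ?s) (?s u) = ?s (a u)"
        using s a au 1(1) by (simp add: mult_word inv_word closed_word del: in_lists_conv_set)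
      then show ?thesis
        using 1(1) au v gv(1) unfolding 1(2)
        by (simp add: at_vertex_below word_sect[OF g v] del: in_lists_conv_set)
    next
      case 2
      have tk: "take (length v) w \<in> lists X" "drop (length v) w \<in> lists X"
        using w by (auto dest: in_set_takeD in_set_dropD)
      have "take (length (g v)) (g w) \<noteq> g v"
      proof
        assume eq: "take (length (g v)) (g w) = g v"
        then have "length v \<le> length w"
          using gv(2) length_word[OF g w] by (metis length_take min.absorb_iff2 min.commute)
        then have "length (g (take (length v) w)) = length v"
          using length_word[OF g tk(1)] by simp
        moreover have "g w = g (take (length v) w) @ sect X g (take (length v) w) (drop (length v) w)"
          using word_sect[OF g tk] by simp
        ultimately have "take (length v) (g w) = g (take (length v) w)" by simp
        then have "g (take (length v) w) = g v" using eq gv(2) by simp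
        then show False using 2 inj_word[OF g tk(1) v] by simp
      qed
      then show ?thesis
        using 2 w closed_word[OF g w] by (simp add: at_vertex_elsewhere del: in_lists_conv_set)
    qed
    then show "(g \<otimes> at_vertex X v a) w = (at_vertex X (g v) (?s \<otimes> a \<otimes> inv ?s) \<otimes> g) w"
      using mult_word[OF g av w] mult_word[OF cc g w] by simp
  qed (use g av cc in simp_all)
  then show ?thesis using g av cc by (simp add: m_assoc)
qed

section \<open>Perfect layered groups have the congruence subgroup property\<close>

lemma level_stabiliser_mono:
  assumes "m \<le> n"
  shows "level_stabiliser X G n \<subseteq> level_stabiliser X G m"
proof
  fix g assume g: "g \<in> level_stabiliser X G n"
  then have gG: "g \<in> carrier G" by (simp add: level_stabiliser_def)
  obtain x where x: "x \<in> X" using nonempty_X by blast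
  have "g v = v" if v: "v \<in> lists X" "length v = m" for v
  proof -
    let ?u = "replicate (n - m) x"
    have u: "?u \<in> lists X" using x by auto
    have "g (v @ ?u) = v @ ?u"
      using g v u assms by (simp add: level_stabiliser_def)
    then show ?thesis
      using word_sect[OF gG v(1) u] length_word[OF gG v(1)] by simp
  qed
  then show "g \<in> level_stabiliser X G m" using gG by (simp add: level_stabiliser_def)
qed

text \<open>Each nontrivial element moves some word, and then acts nontrivially on every deeper level as
  well; for finitely many elements the maximal length of such words is a common depth.\<close>

lemma finite_imp_trivial_level_stabiliser:
  assumes "finite (carrier G)"
  shows "\<exists>n. level_stabiliser X G n = {\<one>}"
proof -
  have "\<exists>v\<in>lists X. g v \<noteq> v" if "g \<in> carrier G" "g \<noteq> \<one>" for g
    using that word_eqI[OF that(1) one_closed] one_word by metis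
  then obtain f where f: "\<And>g. g \<in> carrier G \<Longrightarrow> g \<noteq> \<one> \<Longrightarrow> f g \<in> lists X \<and> g (f g) \<noteq> f g"
    by metis
  define n where "n = Max (insert 0 ((\<lambda>g. length (f g)) ` carrier G))"
  have "g = \<one>" if g: "g \<in> level_stabiliser X G n" for g
  proof (rule ccontr)
    assume "g \<noteq> \<one>"
    moreover have gG: "g \<in> carrier G" using g by (simp add: level_stabiliser_def)
    moreover have "length (f g) \<le> n" using gG assms unfolding n_def by (intro Max_ge) auto
    then have "g \<in> level_stabiliser X G (length (f g))" using g level_stabiliser_mono by blast
    ultimately show False
      using f[of g] by (auto simp: level_stabiliser_def simp del: in_lists_conv_set)
  qed
  moreover have "\<one> \<in> level_stabiliser X G n"
    by (simp add: level_stabiliser_def one_word)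
  ultimately show ?thesis by blast
qed

lemma level_stabiliser_eq_one:
  assumes g: "g \<in> level_stabiliser X G n"
    and triv: "\<And>w. w \<in> lists X \<Longrightarrow> length w = n \<Longrightarrow> sect X g w = \<one>"
  shows "g = \<one>"
proof -
  have gG: "g \<in> carrier G" using g by (simp add: level_stabiliser_def)
  obtain x where x: "x \<in> X" using nonempty_X by blast
  have "g w = w" if w: "w \<in> lists X" for w
  proof (cases "length w \<le> n")
    case True
    then have "g \<in> level_stabiliser X G (length w)" using g level_stabiliser_mono by blast
    then show ?thesis using w by (simp add: level_stabiliser_def)
  next
    case False
    have tk: "take n w \<in> lists X" "drop n w \<in> lists X" "length (take n w) = n"
      using w False by (auto dest: in_set_takeD in_set_dropD)
    moreover have "g (take n w) = take n w"
      using g tk by (simp add: level_stabiliser_def)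
    ultimately have "g (take n w @ drop n w) = take n w @ drop n w"
      using word_sect[OF gG tk(1,2)] triv[OF tk(1,3)] one_word[OF tk(2)] by simp
    then show ?thesis by simp
  qed
  then show ?thesis using word_eqI[OF gG one_closed] one_word by simp
qed

lemma finite_level: "finite {w \<in> lists X. length w = n}"
  using finite_lists_length_eq[OF finite_X, of n]
  by (rule rev_finite_subset) auto

text \<open>An element of the stabiliser of level \<open>n\<close> is the product of its restrictions to the subtrees
  below the words of that level. The induction on a finite set \<open>W\<close> of such words peels off one
  restriction at a time, for elements whose sections outside \<open>W\<close> are trivial.\<close>

lemma level_stabiliser_subset:
  assumes N: "subgroup N G"
    and at: "\<And>w a. w \<in> lists X \<Longrightarrow> length w = n \<Longrightarrow> a \<in> carrier G \<Longrightarrow> at_vertex X w a \<in> N"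
  shows "level_stabiliser X G n \<subseteq> N"
proof -
  let ?L = "{w \<in> lists X. length w = n}"
  have "g \<in> N"
    if "finite W" "W \<subseteq> ?L" "g \<in> level_stabiliser X G n" "\<And>w. w \<in> ?L - W \<Longrightarrow> sect X g w = \<one>" for W g
    using that
  proof (induction W arbitrary: g rule: finite_induct)
    case empty
    then have "g = \<one>" using level_stabiliser_eq_one by blast
    then show ?case using subgroup.one_closed[OF N] by simp
  next
    case (insert v W)
    have gG: "g \<in> carrier G" and gfix: "\<And>w. w \<in> lists X \<Longrightarrow> length w = n \<Longrightarrow> g w = w"
      using insert.prems(2) by (auto simp: level_stabiliser_def)
    have v: "v \<in> lists X" "length v = n" using insert.prems(1) by auto
    have s: "sect X g v \<in> carrier G" by (rule sect_closed[OF gG v(1)])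
    have sinv: "inv (sect X g v) \<in> carrier G" using s by simp
    let ?h = "at_vertex X v (inv (sect X g v))"
    have hN: "?h \<in> N" and hG: "?h \<in> carrier G"
      using at[OF v sinv] at_vertex_closed[OF v(1) sinv] .
    have hfix: "?h w = w" if "w \<in> lists X" "length w = n" for w
      using at_vertex_stabilises_level[OF v(1) sinv] v(2) that by (simp add: level_stabiliser_def)
    have "?h \<otimes> g \<in> N"
    proof (rule insert.IH)
      show "W \<subseteq> ?L" using insert.prems(1) by blast
      show "?h \<otimes> g \<in> level_stabiliser X G n"
        using hG gG hfix gfix by (simp add: level_stabiliser_def mult_word del: in_lists_conv_set)
      show "sect X (?h \<otimes> g) w = \<one>" if "w \<in> ?L - W" for w
      proof -
        have w: "w \<in> lists X" "length w = n" "w \<notin> W" using that by auto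
        have "sect X (?h \<otimes> g) w = sect X ?h w \<otimes> sect X g w"
          using sect_mult[OF hG gG w(1)] gfix[OF w(1,2)] by simp
        also have "\<dots> = \<one>"
          using sect_at_vertex[OF v(1) sinv w(1)] w v s insert.prems(3)[of w] by auto
        finally show ?thesis .
      qed
    qed
    then have "inv ?h \<otimes> (?h \<otimes> g) \<in> N"
      by (rule subgroup.m_closed[OF N subgroup.m_inv_closed[OF N hN]])
    then show ?case using hG gG by (simp add: m_assoc[symmetric])
  qed
  from this[OF finite_level order_refl] show ?thesis by blast
qed

text \<open>Perfectness is what turns the commutators \<open>\<delta>\<^sub>v [a, b]\<close> into arbitrary elements of the copy of
  \<open>G\<close> at \<open>v\<close>.\<close>

lemma perfect_nontrivial_normal_contains_level_stabiliser:
  assumes perfect: "perfect_group G" and N: "N \<lhd> G" and g: "g \<in> N" "g \<noteq> \<one>"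
  shows "\<exists>n. level_stabiliser X G n \<subseteq> N"
proof -
  interpret N: normal N G by (rule N)
  have gG: "g \<in> carrier G" using g N.subset by blast
  obtain v where v: "v \<in> lists X" "g v \<noteq> v"
    using g(2) word_eqI[OF gG one_closed] one_word by metis
  have gv: "g v \<in> lists X" "length (g v) = length v"
    using closed_word[OF gG v(1)] length_word[OF gG v(1)] .
  interpret at: group_hom G G "at_vertex X v" by (rule at_vertex_hom[OF v(1)])
  have comm: "at_vertex X v (a \<otimes> b \<otimes> inv a \<otimes> inv b) \<in> N"
    if a: "a \<in> carrier G" and b: "b \<in> carrier G" for a b
  proof -
    let ?A = "at_vertex X v a" and ?B = "at_vertex X v b"
    \<comment> \<open>\<open>?A \<otimes> ?C\<close> is the commutator of \<open>?A\<close> and \<open>g\<close>; its second factor is supported below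
      \<open>g v\<close>, away from \<open>v\<close>.\<close>
    let ?C = "g \<otimes> at_vertex X v (inv a) \<otimes> inv g"
    have cl: "?A \<in> carrier G" "?B \<in> carrier G" "?C \<in> carrier G"
      using a b gG by simp_all
    have ia: "inv a \<in> carrier G" using a by simp
    have s: "sect X g v \<in> carrier G" by (rule sect_closed[OF gG v(1)])
    have "?C \<otimes> ?B = ?B \<otimes> ?C"
      unfolding conjugate_at_vertex[OF gG v(1) ia]
      by (rule at_vertex_commute) (use gv v b s ia in auto)
    moreover have "?A \<otimes> ?C \<in> N"
    proof -
      have "?A \<otimes> g \<otimes> inv ?A \<in> N" by (rule N.inv_op_closed2[OF cl(1) g(1)])
      then have "?A \<otimes> g \<otimes> inv ?A \<otimes> inv g \<in> N" using g(1) by blast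
      moreover have "?A \<otimes> g \<otimes> inv ?A \<otimes> inv g = ?A \<otimes> ?C"
        using a gG cl by (simp add: m_assoc)
      ultimately show ?thesis by simp
    qed
    ultimately have "?A \<otimes> ?B \<otimes> inv ?A \<otimes> inv ?B \<in> N"
      using cl by (intro N.commutator_of_commuting_factor[of ?A ?C])
    then show ?thesis using a b by simp
  qed
  have "at_vertex X v ` carrier G \<subseteq> N"
  proof -
    have "at_vertex X v ` carrier G = at_vertex X v ` derived G (carrier G)"
      using perfect by (simp add: perfect_group_def)
    also have "\<dots> = generate G (at_vertex X v ` derived_set G (carrier G))"
      unfolding derived_def using at.generate_img[OF derived_set_in_carrier] by simp
    also have "\<dots> \<subseteq> N"
      by (rule generate_subgroup_incl[OF _ N.is_subgroup]) (use comm in auto)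
    finally show ?thesis .
  qed
  then have at_v: "at_vertex X v a \<in> N" if "a \<in> carrier G" for a using that by blast
  have "at_vertex X w a \<in> N" if w: "w \<in> lists X" "length w = length v" and a: "a \<in> carrier G" for w a
  proof -
    obtain h where h: "h \<in> carrier G" "h v = w"
      using layered_G w v by (metis layered_def spherically_transitive_def)
    let ?s = "sect X h v"
    have s: "?s \<in> carrier G" by (rule sect_closed[OF h(1) v(1)])
    have c: "inv ?s \<otimes> a \<otimes> ?s \<in> carrier G" using s a by simp
    \<comment> \<open>Conjugating by \<open>h\<close> twists by its section, so \<open>a\<close> is untwisted first.\<close>
    have "h \<otimes> at_vertex X v (inv ?s \<otimes> a \<otimes> ?s) \<otimes> inv h \<in> N"
      by (rule N.inv_op_closed2[OF h(1) at_v[OF c]])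
    also have "h \<otimes> at_vertex X v (inv ?s \<otimes> a \<otimes> ?s) \<otimes> inv h = at_vertex X w (?s \<otimes> (inv ?s \<otimes> a \<otimes> ?s) \<otimes> inv ?s)"
      using conjugate_at_vertex[OF h(1) v(1) c] h(2) by simp
    also have "?s \<otimes> (inv ?s \<otimes> a \<otimes> ?s) \<otimes> inv ?s = (?s \<otimes> inv ?s) \<otimes> a \<otimes> (?s \<otimes> inv ?s)"
      using s a by (simp only: m_assoc m_closed inv_closed)
    also have "\<dots> = a" using s a by simp
    finally show ?thesis .
  qed
  then show ?thesis using level_stabiliser_subset[OF N.is_subgroup] by blast
qed

lemma perfect_imp_congruence_subgroup_property:
  assumes "perfect_group G"
  shows "congruence_subgroup_property X G"
  unfolding congruence_subgroup_property_def
proof (intro allI impI, elim conjE)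
  fix N assume N: "N \<lhd> G" and fin: "finite (rcosets N)"
  interpret N: normal N G by (rule N)
  show "\<exists>n. level_stabiliser X G n \<subseteq> N"
  proof (cases "N = {\<one>}")
    case True
    have "(\<lambda>a. {a}) ` carrier G \<subseteq> rcosets N"
      unfolding True by (auto simp: RCOSETS_def r_coset_def)
    then have "finite ((\<lambda>a. {a}) ` carrier G)" using fin by (rule finite_subset)
    then have "finite (carrier G)" by (rule finite_imageD) simp
    then show ?thesis using finite_imp_trivial_level_stabiliser True by blast
  next
    case False
    then obtain g where "g \<in> N" "g \<noteq> \<one>" using N.one_closed by blast
    then show ?thesis
      using perfect_nontrivial_normal_contains_level_stabiliser[OF assms N] by blast
  qed
qed

section \<open>Products of sections in an abelian group\<close>

lemma level_bij:
  assumes g: "g \<in> carrier G"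
  shows "inj_on g {w \<in> lists X. length w = n}"
    "g ` {w \<in> lists X. length w = n} = {w \<in> lists X. length w = n}"
proof -
  show inj: "inj_on g {w \<in> lists X. length w = n}"
    using inj_word[OF g] by (auto intro!: inj_onI)
  show "g ` {w \<in> lists X. length w = n} = {w \<in> lists X. length w = n}"
    using closed_word[OF g] length_word[OF g]
    by (intro endo_inj_surj[OF finite_level _ inj]) auto
qed

text \<open>The section of \<open>g \<otimes> h\<close> at \<open>w\<close> is the section of \<open>g\<close> at \<open>h w\<close> times that of \<open>h\<close> at \<open>w\<close>. The target
  is abelian and \<open>h\<close> permutes the level, so the product over the level does not see the shift from \<open>w\<close> to \<open>h w\<close>.\<close>

lemma section_product_hom:
  assumes C: "comm_group C" and p: "p \<in> hom G C"
  shows "(\<lambda>g. finprod C (\<lambda>w. p (sect X g w)) {w \<in> lists X. length w = n}) \<in> hom G C"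
proof (rule homI)
  interpret C: comm_group C by (rule C)
  let ?L = "{w \<in> lists X. length w = n}"
  have cl: "(\<lambda>w. p (sect X g w)) \<in> ?L \<rightarrow> carrier C" if "g \<in> carrier G" for g
    using that hom_in_carrier[OF p] sect_closed by auto
  show "finprod C (\<lambda>w. p (sect X g w)) ?L \<in> carrier C" if "g \<in> carrier G" for g
    using cl[OF that] by simp
  fix g h assume g: "g \<in> carrier G" and h: "h \<in> carrier G"
  have cl2: "(\<lambda>w. p (sect X g (h w))) \<in> ?L \<rightarrow> carrier C"
    using cl[OF g] level_bij(2)[OF h, of n] by blast
  have "finprod C (\<lambda>w. p (sect X (g \<otimes> h) w)) ?L =
      finprod C (\<lambda>w. p (sect X g (h w)) \<otimes>\<^bsub>C\<^esub> p (sect X h w)) ?L"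
  proof (rule C.finprod_cong')
    show "(\<lambda>w. p (sect X g (h w)) \<otimes>\<^bsub>C\<^esub> p (sect X h w)) \<in> ?L \<rightarrow> carrier C"
      using cl2 cl[OF h] by blast
    fix w assume "w \<in> ?L"
    then have w: "w \<in> lists X" by simp
    show "p (sect X (g \<otimes> h) w) = p (sect X g (h w)) \<otimes>\<^bsub>C\<^esub> p (sect X h w)"
      unfolding sect_mult[OF g h w]
      by (rule hom_mult[OF p sect_closed[OF g closed_word[OF h w]] sect_closed[OF h w]])
  qed simp
  also have "\<dots> = finprod C (\<lambda>w. p (sect X g (h w))) ?L \<otimes>\<^bsub>C\<^esub> finprod C (\<lambda>w. p (sect X h w)) ?L"
    by (rule C.finprod_multf[OF cl2 cl[OF h]])
  also have "finprod C (\<lambda>w. p (sect X g (h w))) ?L = finprod C (\<lambda>w. p (sect X g w)) ?L"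
    using C.finprod_reindex[of "\<lambda>w. p (sect X g w)" h ?L] cl[OF g] level_bij[OF h, of n] by simp
  finally show "finprod C (\<lambda>w. p (sect X (g \<otimes> h) w)) ?L =
      finprod C (\<lambda>w. p (sect X g w)) ?L \<otimes>\<^bsub>C\<^esub> finprod C (\<lambda>w. p (sect X h w)) ?L" .
qed

text \<open>All factors other than the one at \<open>v\<close> are trivial. Hence \<open>p\<close> can be
  recovered from the section product on the copy of \<open>G\<close> at \<open>v\<close>, however deep \<open>v\<close> is.\<close>

lemma section_product_at_vertex:
  assumes C: "comm_group C" and p: "p \<in> hom G C" and v: "v \<in> lists X" and a: "a \<in> carrier G"
  shows "finprod C (\<lambda>w. p (sect X (at_vertex X v a) w)) {w \<in> lists X. length w = length v} = p a"
proof -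
  interpret C: comm_group C by (rule C)
  interpret p: group_hom G C p
    using p C.is_group by (intro group_hom.intro group_hom_axioms.intro is_group)
  let ?L = "{w \<in> lists X. length w = length v}"
  have "finprod C (\<lambda>w. p (sect X (at_vertex X v a) w)) ?L =
      finprod C (\<lambda>w. if v = w then p a else \<one>\<^bsub>C\<^esub>) ?L"
    using a by (intro C.finprod_cong') (auto simp: sect_at_vertex[OF v a])
  also have "\<dots> = p a"
    using C.finprod_singleton[of v ?L "\<lambda>_. p a"] finite_level v a by simp
  finally show ?thesis .
qed

text \<open>For the projection \<open>p\<close> onto \<open>G/G'\<close>, the section product kills \<open>G'\<close> but sends the copy of \<open>a\<close> at a
  word of length \<open>n\<close> to the class of \<open>a\<close>.\<close>

lemma level_stabiliser_in_derived_imp_perfect: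
  assumes St: "level_stabiliser X G n \<subseteq> derived G (carrier G)"
  shows "perfect_group G"
proof -
  let ?N = "derived G (carrier G)"
  interpret N: normal ?N G by (rule derived_self_is_normal)
  let ?Q = "G Mod ?N"
  interpret Q: comm_group ?Q by (rule derived_quot_is_comm_group)
  let ?p = "\<lambda>g. ?N #> g"
  have p: "?p \<in> hom G ?Q" by (rule N.r_coset_hom_Mod)
  let ?t = "\<lambda>g. finprod ?Q (\<lambda>w. ?p (sect X g w)) {w \<in> lists X. length w = n}"
  interpret t: group_hom G ?Q ?t
    using section_product_hom[OF Q.comm_group_axioms p]
    by (intro group_hom.intro group_hom_axioms.intro is_group Q.is_group)
  have t_img: "?t ` carrier G \<subseteq> carrier ?Q"
    by (rule image_subsetI) (rule t.hom_closed)
  have t_derived: "?t ` ?N = {\<one>\<^bsub>?Q\<^esub>}"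
    using t.derived_img[of "carrier G"] Q.derived_eq_singleton[OF t_img] by simp
  obtain x where x: "x \<in> X" using nonempty_X by blast
  define v where "v = replicate n x"
  have v: "v \<in> lists X" "length v = n" using x by (auto simp: v_def)
  have "a \<in> ?N" if a: "a \<in> carrier G" for a
  proof -
    have "at_vertex X v a \<in> ?N" using at_vertex_stabilises_level[OF v(1) a] v(2) St by blast
    then have "?t (at_vertex X v a) = \<one>\<^bsub>?Q\<^esub>" using t_derived by blast
    then have "?p a = \<one>\<^bsub>?Q\<^esub>"
      using section_product_at_vertex[OF Q.comm_group_axioms p v(1) a] v(2) by simp
    then show ?thesis using rcos_self[OF a N.is_subgroup] by (simp add: FactGroup_def)
  qed
  then show ?thesis
    using derived_in_carrier[of "carrier G"] by (auto simp: perfect_group_def)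
qed

lemma congruence_subgroup_property_iff_perfect:
  assumes "finite (rcosets (derived G (carrier G)))"
  shows "congruence_subgroup_property X G \<longleftrightarrow> perfect_group G"
proof
  assume "congruence_subgroup_property X G"
  then obtain n where "level_stabiliser X G n \<subseteq> derived G (carrier G)"
    using assms derived_self_is_normal unfolding congruence_subgroup_property_def by blast
  then show "perfect_group G" by (rule level_stabiliser_in_derived_imp_perfect)
qed (rule perfect_imp_congruence_subgroup_property)

end

section \<open>Finiteness of the abelianisation of a constant spinal group\<close>

context constant_spinal
begin

text \<open>Words starting with the identity letter are handled by induction on the length, because a
  directed automorphism is its own section there.\<close>

lemma directed_eqI:
  assumes d: "directed R d" and d': "directed R d'"
    and eq: "\<And>x. x \<in> carrier R - {\<one>} \<Longrightarrow> sect (carrier R) d [x] = sect (carrier R) d' [x]"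
  shows "d = d'"
proof -
  let ?X = "carrier R"
  have t: "d \<in> tree_auts ?X" "d' \<in> tree_auts ?X" using d d' by (auto simp: directed_def)
  have "d w = d' w" if "w \<in> lists ?X" for w
    using that
  proof (induction w)
    case Nil
    then show ?case using tree_autsD(3)[OF t(1)] tree_autsD(3)[OF t(2)] by simp
  next
    case (Cons x w)
    have x: "[x] \<in> lists ?X" using Cons by simp
    have "sect ?X d [x] w = sect ?X d' [x] w"
      using Cons eq[of x] d d' by (cases "x = \<one>") (auto simp: directed_def)
    moreover have "d [x] = [x]" "d' [x] = [x]" using Cons(1) d d' by (auto simp: directed_def)
    ultimately show ?case
      using append_sect[OF t(1) x Cons(2)] append_sect[OF t(2) x Cons(2)] by simp
  qed
  then show ?thesis
    using extensionalityI[OF tree_autsD(1)[OF t(1)] tree_autsD(1)[OF t(2)]] by blast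
qed

lemma finite_D: "finite D"
proof -
  let ?f = "\<lambda>d. \<lambda>x\<in>carrier R - {\<one>}. sect (carrier R) d [x]"
  have "?f ` D \<subseteq> (carrier R - {\<one>}) \<rightarrow>\<^sub>E (rooted R ` carrier R)"
  proof (rule image_subsetI)
    fix d assume "d \<in> D"
    then show "?f d \<in> (carrier R - {\<one>}) \<rightarrow>\<^sub>E (rooted R ` carrier R)"
      using directed_D[of d] by (simp add: directed_def restrict_PiE_iff)
  qed
  moreover have "finite ((carrier R - {\<one>}) \<rightarrow>\<^sub>E (rooted R ` carrier R))"
    using finite_R by (intro finite_PiE) auto
  ultimately have "finite (?f ` D)" by (rule finite_subset)
  moreover have "inj_on ?f D"
  proof (rule inj_onI)
    fix d d' assume dd: "d \<in> D" "d' \<in> D" "?f d = ?f d'"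
    have "sect (carrier R) d [x] = sect (carrier R) d' [x]" if "x \<in> carrier R - {\<one>}" for x
      using fun_cong[OF dd(3), of x] that by simp
    then show "d = d'" by (rule directed_eqI[OF directed_D[OF dd(1)] directed_D[OF dd(2)]])
  qed
  ultimately show ?thesis by (rule finite_imageD)
qed

text \<open>The defining condition on the sections of \<open>D\<close> exhibits the set of rooted automorphisms as a
  generated subgroup.\<close>

lemma subgroup_rooted: "subgroup (rooted R ` carrier R) (Aut_tree (carrier R))"
proof -
  have "{sect (carrier R) d [x] | d x. d \<in> D \<and> x \<in> carrier R - {\<one>}} \<subseteq> carrier (Aut_tree (carrier R))"
    using directed_D by (auto simp: Aut_tree_def directed_def intro!: sect_in_tree_auts)
  from group.generate_is_subgroup[OF group_Aut_tree this] show ?thesis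
    unfolding generate_sections .
qed

lemma subgroup_spinal_group:
  "subgroup (carrier (spinal_group R D)) (Aut_tree (carrier R))"
proof -
  have "rooted R ` carrier R \<union> D \<subseteq> carrier (Aut_tree (carrier R))"
    using subgroup.subset[OF subgroup_rooted] subgroup.subset[OF subgroup_D] by blast
  from group.generate_is_subgroup[OF group_Aut_tree this] show ?thesis
    by (simp add: spinal_group_def)
qed

lemma finite_abelianisation_spinal_group:
  defines "G \<equiv> spinal_group R D"
  shows "finite (rcosets\<^bsub>G\<^esub> (derived G (carrier G)))"
proof -
  let ?A = "Aut_tree (carrier R)" and ?R = "rooted R ` carrier R"
  have G: "G = ?A\<lparr>carrier := carrier G\<rparr>" by (simp add: G_def spinal_group_def)
  have sub: "subgroup (carrier G) ?A" unfolding G_def by (rule subgroup_spinal_group)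
  have gen: "carrier G = generate ?A (?R \<union> D)" by (simp add: G_def spinal_group_def)
  have incl: "?R \<union> D \<subseteq> carrier G" unfolding gen by (auto intro: generate.incl)
  have "subgroup ?R G" "subgroup D G"
    using group.subgroup_incl[OF group_Aut_tree subgroup_rooted sub]
      group.subgroup_incl[OF group_Aut_tree subgroup_D sub] incl
    unfolding G[symmetric] by blast+
  moreover have "carrier G = generate G (?R \<union> D)"
    using group.generate_consistent[OF group_Aut_tree incl sub] unfolding G[symmetric] gen[symmetric]
    by (rule sym)
  moreover have "group G" unfolding G_def by (rule group_spinal_group)
  ultimately show ?thesis
    using group.finite_abelianisation[of G ?R D] finite_R finite_D by simp
qed

end

section \<open>The congruence subgroup property of layered constant spinal groups\<close>

theorem proposition5p4:
  fixes R :: "('a, 'b) monoid_scheme" and D :: "('a list \<Rightarrow> 'a list) set"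
  assumes "constant_spinal R D"
    and "layered (carrier R) (spinal_group R D)"
  shows "congruence_subgroup_property (carrier R) (spinal_group R D) \<longleftrightarrow>
    perfect_group (spinal_group R D)"
proof -
  interpret constant_spinal R D by (rule assms(1))
  interpret S: layered_tree_group "carrier R" "spinal_group R D"
  proof (rule layered_tree_group.intro)
    show "finite (carrier R)" by (rule finite_R)
    show "carrier R \<noteq> {}" using one_closed by blast
    show "subgroup (carrier (spinal_group R D)) (Aut_tree (carrier R))"
      by (rule subgroup_spinal_group)
    show "spinal_group R D = Aut_tree (carrier R)\<lparr>carrier := carrier (spinal_group R D)\<rparr>"
      by (simp add: spinal_group_def)
    show "layered (carrier R) (spinal_group R D)" by (rule assms(2))
  qed
  show ?thesis
    by (rule S.congruence_subgroup_property_iff_perfect[OF finite_abelianisation_spinal_group])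
qed

end
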